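(* The parameterized problem Stable Cutset[vc] admits a polynomial kernelization to equivalent instances with $\mathcal{O}(|X|^3)$ vertices. That is, there is an algorithm running in time polynomial in the input size which, given a graph $G$ and a vertex cover $X$ of $G$, outputs a graph $G'$ and a vertex cover $X'$ of $G'$ such that $G'$ has a stable cutset if and only if $G$ has a stable cutset, and $|V(G')|\le c\cdot |X|^3$ for some absolute constant $c$.
   Context: All graphs are finite and simple. A stable cutset of a graph $G$ is a set $S\subseteq V(G)$ whose vertices are pairwise non-adjacent and such that $G-S$ is disconnected (has at least two connected components); the empty set is a stable cutset of any disconnected graph. A vertex cover of $G$ is a set $X\subseteq V(G)$ such that $V(G)\setminus X$ is a stable set. Stable Cutset[vc]: input is a graph $G$ and a vertex cover $X$ of $G$; the parameter is $|X|$; the question is whether $G$ has a stable cutset. A kernelization may alternatively output a constant-size yes- or no-instance. *)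

theory Defs
  imports
    "Graph_Theory.Graph_Theory"
    "HOL-Computational_Algebra.Polynomial"
begin

section \<open>Stable cutsets and vertex covers\<close>

text \<open>
  A finite simple graph is a \<^term>\<open>pair_graph\<close>: finitely many vertices, a symmetric set of arcs
  without loops.  The edge \<open>{u, v}\<close> is the pair of arcs \<open>(u, v)\<close>, \<open>(v, u)\<close>, and the strongly
  connected components of such a graph are its connected components.
\<close>

definition stable_set :: "'a pair_pre_digraph \<Rightarrow> 'a set \<Rightarrow> bool" where
  "stable_set G S \<longleftrightarrow> S \<subseteq> pverts G \<and> (\<forall>u\<in>S. \<forall>v\<in>S. (u, v) \<notin> parcs G)"

text \<open>
  \<open>\<not> connected (G - S)\<close> would not do here: the library counts the graph without vertices as not
  connected, but it does not have two components.
\<close>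

definition stable_cutset :: "'a pair_pre_digraph \<Rightarrow> 'a set \<Rightarrow> bool" where
  "stable_cutset G S \<longleftrightarrow>
     stable_set G S \<and> 2 \<le> card (pre_digraph.sccs (with_proj G \<restriction> (pverts G - S)))"

definition has_stable_cutset :: "'a pair_pre_digraph \<Rightarrow> bool" where
  "has_stable_cutset G \<longleftrightarrow> (\<exists>S. stable_cutset G S)"

definition vertex_cover :: "'a pair_pre_digraph \<Rightarrow> 'a set \<Rightarrow> bool" where
  "vertex_cover G X \<longleftrightarrow> X \<subseteq> pverts G \<and> stable_set G (pverts G - X)"

section \<open>Model of computation\<close>

text \<open>
  Algorithms are programs of Jones's WHILE language, whose data are binary trees.  A program has
  finitely many variables and the operations cons, head, tail and equality test.
\<close>

datatype data = Nil | Cons data data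

fun data_size :: "data \<Rightarrow> nat" where
  "data_size Nil = 1"
| "data_size (Cons a b) = Suc (data_size a + data_size b)"

fun data_hd :: "data \<Rightarrow> data" where
  "data_hd Nil = Nil"
| "data_hd (Cons a b) = a"

fun data_tl :: "data \<Rightarrow> data" where
  "data_tl Nil = Nil"
| "data_tl (Cons a b) = b"

hide_const (open) Nil Cons

type_synonym store = "nat \<Rightarrow> data"

datatype expr =
    EVar nat
  | ENil
  | ECons expr expr
  | EHd expr
  | ETl expr
  | EEq expr expr

fun eval_expr :: "expr \<Rightarrow> store \<Rightarrow> data" where
  "eval_expr (EVar x) s = s x"
| "eval_expr ENil s = data.Nil"
| "eval_expr (ECons a b) s = data.Cons (eval_expr a s) (eval_expr b s)"
| "eval_expr (EHd a) s = data_hd (eval_expr a s)"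
| "eval_expr (ETl a) s = data_tl (eval_expr a s)"
| "eval_expr (EEq a b) s =
     (if eval_expr a s = eval_expr b s then data.Cons data.Nil data.Nil else data.Nil)"

text \<open>
  Every evaluation of a subexpression is charged with the size of its value, that is, with the
  cost of copying it.  With unit costs, repeating \<open>x := cons x x\<close> would build a value of
  exponential size in linear time; with these costs the size of every value is bounded by the
  running time, and running times agree with those of Turing machines up to a polynomial.
\<close>

fun expr_time :: "expr \<Rightarrow> store \<Rightarrow> nat" where
  "expr_time (EVar x) s = data_size (s x)"
| "expr_time ENil s = 1"
| "expr_time (ECons a b) s =
     expr_time a s + expr_time b s + data_size (eval_expr (ECons a b) s)"
| "expr_time (EHd a) s = expr_time a s + data_size (eval_expr (EHd a) s)"
| "expr_time (ETl a) s = expr_time a s + data_size (eval_expr (ETl a) s)"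
| "expr_time (EEq a b) s =
     expr_time a s + expr_time b s + data_size (eval_expr (EEq a b) s)"

datatype com =
    Skip
  | Assign nat expr
  | Seq com com
  | If expr com com
  | While expr com

text \<open>
  \<open>exec c s t s'\<close>: started in store \<open>s\<close>, the program \<open>c\<close> terminates after time \<open>t\<close> in store \<open>s'\<close>.
  A test succeeds if its value is not nil.
\<close>

inductive exec :: "com \<Rightarrow> store \<Rightarrow> nat \<Rightarrow> store \<Rightarrow> bool" where
  exec_Skip: "exec Skip s 1 s"
| exec_Assign: "exec (Assign x e) s (Suc (expr_time e s)) (s(x := eval_expr e s))"
| exec_Seq: "exec c1 s t1 s1 \<Longrightarrow> exec c2 s1 t2 s2 \<Longrightarrow> exec (Seq c1 c2) s (t1 + t2) s2"
| exec_IfTrue: "eval_expr e s \<noteq> data.Nil \<Longrightarrow> exec c1 s t s' \<Longrightarrow>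
     exec (If e c1 c2) s (Suc (expr_time e s + t)) s'"
| exec_IfFalse: "eval_expr e s = data.Nil \<Longrightarrow> exec c2 s t s' \<Longrightarrow>
     exec (If e c1 c2) s (Suc (expr_time e s + t)) s'"
| exec_WhileFalse: "eval_expr e s = data.Nil \<Longrightarrow>
     exec (While e c) s (Suc (expr_time e s)) s"
| exec_WhileTrue: "eval_expr e s \<noteq> data.Nil \<Longrightarrow> exec c s t1 s1 \<Longrightarrow>
     exec (While e c) s1 t2 s2 \<Longrightarrow>
     exec (While e c) s (Suc (expr_time e s + t1 + t2)) s2"

text \<open>Variable \<open>0\<close> holds the input and the output; the other variables are initially nil.\<close>

definition computes :: "com \<Rightarrow> data \<Rightarrow> nat \<Rightarrow> data \<Rightarrow> bool" where
  "computes c w t w' \<longleftrightarrow> (\<exists>s. exec c ((\<lambda>_. data.Nil)(0 := w)) t s \<and> s 0 = w')"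

lemma exec_deterministic:
  "exec c s t s' \<Longrightarrow> exec c s u s'' \<Longrightarrow> t = u \<and> s' = s''"
proof (induction arbitrary: u s'' rule: exec.induct)
  case exec_Skip
  then show ?case by (auto elim: exec.cases)
next
  case exec_Assign
  then show ?case by (auto elim: exec.cases)
next
  case (exec_Seq c1 s t1 s1 c2 t2 s2)
  from exec_Seq.prems show ?case
    by (cases rule: exec.cases) (use exec_Seq.IH in blast)
next
  case (exec_IfTrue e s c1 t s' c2)
  from exec_IfTrue.prems show ?case
    by (cases rule: exec.cases) (use exec_IfTrue in blast)+
next
  case (exec_IfFalse e s c2 t s' c1)
  from exec_IfFalse.prems show ?case
    by (cases rule: exec.cases) (use exec_IfFalse in blast)+
next
  case (exec_WhileFalse e s c)
  from exec_WhileFalse.prems show ?case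
    by (cases rule: exec.cases) (use exec_WhileFalse in blast)+
next
  case (exec_WhileTrue e s c t1 s1 t2 s2)
  from exec_WhileTrue.prems show ?case
    by (cases rule: exec.cases) (use exec_WhileTrue in blast)+
qed

section \<open>Encoding of instances\<close>

fun encode_list :: "('a \<Rightarrow> data) \<Rightarrow> 'a list \<Rightarrow> data" where
  "encode_list f [] = data.Nil"
| "encode_list f (x # xs) = data.Cons (f x) (encode_list f xs)"

definition encode_bool :: "bool \<Rightarrow> data" where
  "encode_bool b = (if b then data.Cons data.Nil data.Nil else data.Nil)"

text \<open>Vertex names are written in binary, least significant bit first.\<close>

fun bits :: "nat \<Rightarrow> bool list" where
  "bits n = (if n = 0 then [] else odd n # bits (n div 2))"

declare bits.simps [simp del]

definition encode_nat :: "nat \<Rightarrow> data" where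
  "encode_nat n = encode_list encode_bool (bits n)"

definition encode_edge :: "nat \<times> nat \<Rightarrow> data" where
  "encode_edge e = data.Cons (encode_nat (fst e)) (encode_nat (snd e))"

text \<open>
  An instance \<open>(G, X)\<close> is given by a list of the vertices of \<open>G\<close>, a list of its edges and a list of
  the elements of \<open>X\<close>, in any order and without repetitions; each edge occurs in one of its two
  orientations.
\<close>

definition encodes_instance :: "data \<Rightarrow> nat pair_pre_digraph \<Rightarrow> nat set \<Rightarrow> bool" where
  "encodes_instance w G X \<longleftrightarrow>
     (\<exists>vs es xs.
        w = data.Cons (encode_list encode_nat vs)
              (data.Cons (encode_list encode_edge es) (encode_list encode_nat xs)) \<and>
        distinct vs \<and> set vs = pverts G \<and>
        distinct (map (\<lambda>(u, v). {u, v}) es) \<and> set es \<union> (set es)\<inverse> = parcs G \<and>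
        distinct xs \<and> set xs = X)"

lemma inj_encode_list: "inj f \<Longrightarrow> inj (encode_list f)"
proof (rule injI)
  fix xs ys assume "inj f" and "encode_list f xs = encode_list f ys"
  then show "xs = ys"
  proof (induction xs arbitrary: ys)
    case Nil
    then show ?case by (cases ys) auto
  next
    case (Cons x xs)
    then show ?case by (cases ys) (auto dest: injD)
  qed
qed

lemma inj_bits: "inj bits"
proof (rule injI)
  fix m n show "bits m = bits n \<Longrightarrow> m = n"
  proof (induction m arbitrary: n rule: less_induct)
    case (less m)
    show ?case
    proof (cases "m = 0 \<or> n = 0")
      case True
      with less.prems show ?thesis by (auto simp: bits.simps[of m] bits.simps[of n] split: if_splits)
    next
      case False
      with less.prems have "odd m = odd n" "bits (m div 2) = bits (n div 2)"
        by (auto simp: bits.simps[of m] bits.simps[of n])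
      with less.IH[of "m div 2" "n div 2"] False have "m div 2 = n div 2" by simp
      with \<open>odd m = odd n\<close> show ?thesis by presburger
    qed
  qed
qed

lemma inj_encode_nat: "inj encode_nat"
proof -
  have "inj encode_bool" by (auto intro!: injI simp: encode_bool_def split: if_splits)
  then have "inj (encode_list encode_bool \<circ> bits)"
    by (intro inj_compose inj_encode_list inj_bits)
  then show ?thesis by (simp add: encode_nat_def[abs_def] comp_def)
qed

lemma inj_encode_edge: "inj encode_edge"
  by (auto intro!: injI simp: encode_edge_def dest: injD[OF inj_encode_nat])

lemma encodes_instance_unique:
  assumes "encodes_instance w G X" "encodes_instance w H Y"
  shows "pverts G = pverts H" "parcs G = parcs H" "X = Y"
  using assms unfolding encodes_instance_def
  by (auto dest!: injD[OF inj_encode_list[OF inj_encode_nat]]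
      injD[OF inj_encode_list[OF inj_encode_edge]])

end

theory Submission
  imports Defs
begin

text \<open>
  Let \<open>v\<close> be a vertex outside \<open>X\<close>.  If its neighbourhood is stable and \<open>G\<close> has at least three
  vertices, then the neighbourhood, or \<open>{v}\<close> if \<open>G\<close> is a star with centre \<open>v\<close>, is a stable cutset.
  Otherwise every vertex outside \<open>X\<close> lies in a triangle with two vertices of \<open>X\<close>.  Then both sides
  of a separation \<open>(A, S, B)\<close> by a stable set \<open>S\<close> meet \<open>X\<close>, and a separation of \<open>X\<close> extends to \<open>G\<close> if
  and only if no outside vertex has neighbours in all three parts.  This condition only concerns
  triples of \<open>X\<close>, so it suffices to keep, for every triple, one common neighbour outside \<open>X\<close>.
\<close>

section \<open>Execution within a time bound\<close>

definition exec_within :: "com \<Rightarrow> store \<Rightarrow> nat \<Rightarrow> (store \<Rightarrow> bool) \<Rightarrow> bool" where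
  "exec_within c s k Q \<longleftrightarrow> (\<exists>t s'. exec c s t s' \<and> t \<le> k \<and> Q s')"

lemma exec_within_mono:
  assumes "exec_within c s k Q" "k \<le> k'" "\<And>s'. Q s' \<Longrightarrow> Q' s'"
  shows "exec_within c s k' Q'"
  using assms unfolding exec_within_def by (meson order_trans)

lemma exec_within_Assign:
  assumes "Q (s(x := eval_expr e s))"
  shows "exec_within (Assign x e) s (Suc (expr_time e s)) Q"
  using assms exec_Assign unfolding exec_within_def by blast

lemma exec_within_Seq:
  assumes "exec_within c s k Q" "\<And>s'. Q s' \<Longrightarrow> exec_within c' s' k' R"
  shows "exec_within (Seq c c') s (k + k') R"
  using assms unfolding exec_within_def by (meson exec_Seq add_mono)

lemma exec_within_If:
  assumes "eval_expr e s \<noteq> data.Nil \<Longrightarrow> exec_within c s k Q"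
    and "eval_expr e s = data.Nil \<Longrightarrow> exec_within c' s k Q"
  shows "exec_within (If e c c') s (Suc (expr_time e s + k)) Q"
proof (cases "eval_expr e s = data.Nil")
  case True
  with assms(2) obtain t s' where "exec c' s t s'" "t \<le> k" "Q s'"
    unfolding exec_within_def by blast
  then show ?thesis
    unfolding exec_within_def using exec_IfFalse[OF True] by (meson Suc_le_mono add_left_mono)
next
  case False
  with assms(1) obtain t s' where "exec c s t s'" "t \<le> k" "Q s'"
    unfolding exec_within_def by blast
  then show ?thesis
    unfolding exec_within_def using exec_IfTrue[OF False] by (meson Suc_le_mono add_left_mono)
qed

lemma exec_within_WhileFalse:
  assumes "eval_expr e s = data.Nil" "Q s"
  shows "exec_within (While e c) s (Suc (expr_time e s)) Q"
  using assms exec_WhileFalse unfolding exec_within_def by blast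

lemma exec_within_WhileTrue:
  assumes "eval_expr e s \<noteq> data.Nil" "exec_within c s k Q"
    and "\<And>s'. Q s' \<Longrightarrow> exec_within (While e c) s' k' R"
  shows "exec_within (While e c) s (Suc (expr_time e s + k + k')) R"
proof -
  from assms(2) obtain t s' where s': "exec c s t s'" "t \<le> k" "Q s'"
    unfolding exec_within_def by blast
  with assms(3) obtain t' s'' where "exec (While e c) s' t' s''" "t' \<le> k'" "R s''"
    unfolding exec_within_def by blast
  with s' exec_WhileTrue[OF assms(1)] show ?thesis
    unfolding exec_within_def by (meson Suc_le_mono add_mono order_refl)
qed

lemma data_size_eval_expr_le: "data_size (eval_expr e s) \<le> expr_time e s"
  by (cases e) auto

section \<open>Polynomially bounded functions\<close>

definition polybound :: "(data \<Rightarrow> nat) \<Rightarrow> bool" where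
  "polybound g \<longleftrightarrow> (\<exists>p :: nat poly. \<forall>w. g w \<le> poly p (data_size w))"

lemma poly_nat_mono: "m \<le> n \<Longrightarrow> poly p m \<le> poly (p :: nat poly) n"
  by (induction p) (auto intro!: add_mono mult_mono)

lemma polybound_le: "polybound g \<Longrightarrow> (\<And>w. f w \<le> g w) \<Longrightarrow> polybound f"
  unfolding polybound_def by (meson order_trans)

lemma polybound_const: "polybound (\<lambda>_. k)"
  unfolding polybound_def by (rule exI[of _ "[:k:]"]) simp

lemma polybound_data_size: "polybound data_size"
  unfolding polybound_def by (rule exI[of _ "[:0, 1:]"]) simp

lemma polybound_add: "polybound f \<Longrightarrow> polybound g \<Longrightarrow> polybound (\<lambda>w. f w + g w)"
  unfolding polybound_def by (metis add_mono poly_add)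

lemma polybound_mult: "polybound f \<Longrightarrow> polybound g \<Longrightarrow> polybound (\<lambda>w. f w * g w)"
  unfolding polybound_def by (metis mult_le_mono poly_mult)

lemma polybound_Suc: "polybound f \<Longrightarrow> polybound (\<lambda>w. Suc (f w))"
  using polybound_add[OF polybound_const[of 1], of f] by simp

lemma polybound_poly:
  assumes "polybound f"
  shows "polybound (\<lambda>w. poly p (f w))"
proof -
  obtain q where "\<And>w. f w \<le> poly q (data_size w)" using assms by (auto simp: polybound_def)
  then have "\<forall>w. poly p (f w) \<le> poly (pcompose p q) (data_size w)"
    by (simp add: poly_pcompose poly_nat_mono)
  then show ?thesis unfolding polybound_def ..
qed

lemma polybound_comp:
  assumes "polybound T" "polybound (\<lambda>w. data_size (f w))"
  shows "polybound (\<lambda>w. T (f w))"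
proof -
  obtain p where p: "\<And>v. T v \<le> poly p (data_size v)" using assms(1) by (auto simp: polybound_def)
  show ?thesis by (rule polybound_le[OF polybound_poly[OF assms(2)] p])
qed

lemmas polybound_intros = polybound_const polybound_data_size polybound_add polybound_mult
  polybound_Suc polybound_poly

section \<open>Polynomial-time functions on binary trees\<close>

text \<open>The variables from \<open>n\<close> on serve as scratch space and may change arbitrarily.\<close>

definition assigns :: "nat \<Rightarrow> nat \<Rightarrow> data \<Rightarrow> store \<Rightarrow> store \<Rightarrow> bool" where
  "assigns n y d s s' \<longleftrightarrow> s' y = d \<and> (\<forall>z<n. z \<noteq> y \<longrightarrow> s' z = s z)"

lemma exec_within_assigns:
  "exec_within (Assign y e) s (Suc (expr_time e s)) (assigns n y (eval_expr e s) s)"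
  by (rule exec_within_Assign) (simp add: assigns_def)

definition implements :: "com \<Rightarrow> nat \<Rightarrow> nat \<Rightarrow> nat \<Rightarrow> (data \<Rightarrow> data) \<Rightarrow> (data \<Rightarrow> nat) \<Rightarrow> bool" where
  "implements c x y n f T \<longleftrightarrow> (\<forall>s. exec_within c s (T (s x)) (assigns n y (f (s x)) s))"

definition polytime :: "(data \<Rightarrow> data) \<Rightarrow> bool" where
  "polytime f \<longleftrightarrow> polybound (\<lambda>w. data_size (f w)) \<and>
     (\<forall>x y n. x < n \<longrightarrow> y < n \<longrightarrow> (\<exists>c T. polybound T \<and> implements c x y n f T))"

abbreviation polytime_pred :: "(data \<Rightarrow> bool) \<Rightarrow> bool" where
  "polytime_pred P \<equiv> polytime (\<lambda>w. encode_bool (P w))"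

lemma polytime_imp_polybound: "polytime f \<Longrightarrow> polybound (\<lambda>w. data_size (f w))"
  by (simp add: polytime_def)

lemma polytime_imp_implements:
  assumes "polytime f" "x < n" "y < n"
  obtains c T where "polybound T" "implements c x y n f T"
  using assms unfolding polytime_def by blast

lemma implements_exec_within:
  "implements c x y n f T \<Longrightarrow> exec_within c s (T (s x)) (assigns n y (f (s x)) s)"
  by (simp add: implements_def)

lemma polytime_computes:
  assumes "polytime f"
  obtains c p where "\<And>w. \<exists>t. computes c w t (f w) \<and> t \<le> poly p (data_size w)"
proof -
  obtain c T where "polybound T" and impl: "implements c 0 0 1 f T"
    using assms by (rule polytime_imp_implements[of f 0 1 0]) auto
  then obtain p where T_le: "\<And>w. T w \<le> poly p (data_size w)" by (auto simp: polybound_def)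
  have "\<exists>t. computes c w t (f w) \<and> t \<le> poly p (data_size w)" for w
    using implements_exec_within[OF impl, of "(\<lambda>_. data.Nil)(0 := w)"] order_trans[OF _ T_le]
    unfolding exec_within_def computes_def assigns_def by auto
  then show thesis by (rule that)
qed

lemma polytime_id: "polytime (\<lambda>w. w)"
proof -
  have "implements (Assign y (EVar x)) x y n (\<lambda>w. w) (\<lambda>w. Suc (data_size w))" for x y n
    unfolding implements_def using exec_within_assigns[where e = "EVar x"] by simp
  then show ?thesis
    unfolding polytime_def using polybound_data_size polybound_Suc[OF polybound_data_size] by blast
qed

text \<open>The operands of \<open>h\<close> have already been stored in the variables \<open>n\<close> and \<open>n + 1\<close>.\<close>

definition implements_on_operands ::
  "com \<Rightarrow> nat \<Rightarrow> nat \<Rightarrow> nat \<Rightarrow> (data \<Rightarrow> data \<Rightarrow> data \<Rightarrow> data) \<Rightarrow>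
    (data \<Rightarrow> data \<Rightarrow> data \<Rightarrow> nat) \<Rightarrow> bool"
  where
  "implements_on_operands c x y n h T \<longleftrightarrow>
     (\<forall>s. exec_within c s (T (s x) (s n) (s (n + 1))) (assigns n y (h (s x) (s n) (s (n + 1))) s))"

lemma implements_Seq_operands:
  assumes impl_f: "implements cf x n (n + 1) f Tf"
    and impl_g: "implements cg x (n + 1) (n + 2) g Tg"
    and impl_h: "implements_on_operands c x y n h T" and "x < n" "y < n"
  shows "implements (Seq cf (Seq cg c)) x y n (\<lambda>w. h w (f w) (g w))
    (\<lambda>w. Tf w + (Tg w + T w (f w) (g w)))"
  unfolding implements_def
proof (intro allI exec_within_Seq)
  fix s
  show "exec_within cf s (Tf (s x)) (assigns (n + 1) n (f (s x)) s)"
    using impl_f by (rule implements_exec_within)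
next
  fix s s' assume first: "assigns (n + 1) n (f (s x)) s s'"
  show "exec_within cg s' (Tg (s x))
    (\<lambda>s'. s' n = f (s x) \<and> s' (n + 1) = g (s x) \<and> (\<forall>z<n. s' z = s z))"
    by (rule exec_within_mono[OF implements_exec_within[OF impl_g]])
      (use first \<open>x < n\<close> in \<open>auto simp: assigns_def\<close>)
next
  fix s s' assume "s' n = f (s x) \<and> s' (n + 1) = g (s x) \<and> (\<forall>z<n. s' z = s z)"
  then show "exec_within c s' (T (s x) (f (s x)) (g (s x)))
      (assigns n y (h (s x) (f (s x)) (g (s x))) s)"
    using impl_h[unfolded implements_on_operands_def, rule_format, of s'] \<open>x < n\<close> \<open>y < n\<close>
    by (auto elim!: exec_within_mono simp: assigns_def)
qed

lemma polytime_operands: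
  assumes f: "polytime f" and g: "polytime g"
    and size: "polybound (\<lambda>w. data_size (h w (f w) (g w)))"
    and operands: "\<And>x y n. x < n \<Longrightarrow> y < n \<Longrightarrow>
      \<exists>c T. polybound (\<lambda>w. T w (f w) (g w)) \<and> implements_on_operands c x y n h T"
  shows "polytime (\<lambda>w. h w (f w) (g w))"
  unfolding polytime_def
proof (intro conjI allI impI size)
  fix x y n :: nat assume "x < n" "y < n"
  obtain cf Tf where Tf: "polybound Tf" and impl_f: "implements cf x n (n + 1) f Tf"
    using \<open>x < n\<close> by (auto intro: polytime_imp_implements[OF f, of x "n + 1" n])
  obtain cg Tg where Tg: "polybound Tg" and impl_g: "implements cg x (n + 1) (n + 2) g Tg"
    using \<open>x < n\<close> by (auto intro: polytime_imp_implements[OF g, of x "n + 2" "n + 1"])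
  obtain c T where T: "polybound (\<lambda>w. T w (f w) (g w))"
    and impl_h: "implements_on_operands c x y n h T"
    using operands[OF \<open>x < n\<close> \<open>y < n\<close>] by blast
  have "polybound (\<lambda>w. Tf w + (Tg w + T w (f w) (g w)))"
    by (intro polybound_add Tf Tg T)
  with implements_Seq_operands[OF impl_f impl_g impl_h \<open>x < n\<close> \<open>y < n\<close>]
  show "\<exists>c T. polybound T \<and> implements c x y n (\<lambda>w. h w (f w) (g w)) T" by blast
qed

lemma polytime_comp:
  assumes f: "polytime f" and g: "polytime g"
  shows "polytime (\<lambda>w. f (g w))"
proof (rule polytime_operands[OF g g, where h = "\<lambda>_ a _. f a"])
  note size_g = polytime_imp_polybound[OF g]
  show "polybound (\<lambda>w. data_size (f (g w)))"
    by (rule polybound_comp[OF polytime_imp_polybound[OF f] size_g])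
  fix x y n :: nat assume "x < n" "y < n"
  then obtain c T where "polybound T" and impl: "implements c n y (n + 1) f T"
    by (auto intro: polytime_imp_implements[OF f, of n "n + 1" y])
  from \<open>polybound T\<close> size_g have "polybound (\<lambda>w. T (g w))" by (rule polybound_comp)
  moreover have "exec_within c s (T (s n)) (assigns n y (f (s n)) s)" for s
    by (rule exec_within_mono[OF implements_exec_within[OF impl]]) (auto simp: assigns_def)
  then have "implements_on_operands c x y n (\<lambda>_ a _. f a) (\<lambda>_ a _. T a)"
    by (simp add: implements_on_operands_def)
  ultimately show "\<exists>c T. polybound (\<lambda>w. T w (g w) (g w)) \<and>
      implements_on_operands c x y n (\<lambda>_ a _. f a) T"
    by (intro exI conjI)
qed

lemma polytime_expr:
  assumes f: "polytime f" and g: "polytime g"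
    and eval: "\<And>u v s. eval_expr (e u v) s = h (s u) (s v)"
    and time: "\<And>u v s. expr_time (e u v) s \<le> k * (data_size (s u) + data_size (s v)) + k"
  shows "polytime (\<lambda>w. h (f w) (g w))"
proof (rule polytime_operands[OF f g, where h = "\<lambda>_. h"])
  let ?k = "\<lambda>a b. k * (data_size a + data_size b) + k"
  have bound: "polybound (\<lambda>w. ?k (f w) (g w))"
    by (intro polybound_intros polytime_imp_polybound f g)
  have "data_size (h a b) \<le> ?k a b" for a b
    using order_trans[OF data_size_eval_expr_le time, of 0 1 "(\<lambda>_. b)(0 := a)"]
    by (simp add: eval)
  then show "polybound (\<lambda>w. data_size (h (f w) (g w)))" by (rule polybound_le[OF bound])
  fix x y n :: nat
  have "implements_on_operands (Assign y (e n (n + 1))) x y n (\<lambda>_. h) (\<lambda>_ a b. Suc (?k a b))"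
    unfolding implements_on_operands_def eval[symmetric]
    by (intro allI exec_within_mono[OF exec_within_assigns]) (use time in auto)
  with polybound_Suc[OF bound] show "\<exists>c T. polybound (\<lambda>w. T w (f w) (g w)) \<and>
      implements_on_operands c x y n (\<lambda>_. h) T"
    by (intro exI conjI)
qed

lemma polytime_Nil: "polytime (\<lambda>_. data.Nil)"
  using polytime_expr[OF polytime_id polytime_id,
      where e = "\<lambda>_ _. ENil" and h = "\<lambda>_ _. data.Nil" and k = 1] by simp

lemma polytime_Cons: "polytime f \<Longrightarrow> polytime g \<Longrightarrow> polytime (\<lambda>w. data.Cons (f w) (g w))"
  by (rule polytime_expr[where e = "\<lambda>u v. ECons (EVar u) (EVar v)" and k = 2]) auto

lemma data_size_hd_le: "data_size (data_hd d) \<le> data_size d"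
  by (cases d) auto

lemma polytime_hd: "polytime f \<Longrightarrow> polytime (\<lambda>w. data_hd (f w))"
  by (rule polytime_expr[where g = f and e = "\<lambda>u v. EHd (EVar u)"
        and h = "\<lambda>a _. data_hd a" and k = 2])
    (auto intro: order_trans[OF data_size_hd_le])

lemma data_size_tl_le: "data_size (data_tl d) \<le> data_size d"
  by (cases d) auto

lemma polytime_tl: "polytime f \<Longrightarrow> polytime (\<lambda>w. data_tl (f w))"
  by (rule polytime_expr[where g = f and e = "\<lambda>u v. ETl (EVar u)"
        and h = "\<lambda>a _. data_tl a" and k = 2])
    (auto intro: order_trans[OF data_size_tl_le])

lemma polytime_eq: "polytime f \<Longrightarrow> polytime g \<Longrightarrow> polytime_pred (\<lambda>w. f w = g w)"
  by (rule polytime_expr[where e = "\<lambda>u v. EEq (EVar u) (EVar v)"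
        and h = "\<lambda>a b. encode_bool (a = b)" and k = 3])
    (auto simp: encode_bool_def)

lemma polytime_const: "polytime (\<lambda>_. d)"
  by (induction d) (auto intro: polytime_Nil polytime_Cons)

lemma encode_bool_eq_Nil_iff: "encode_bool b = data.Nil \<longleftrightarrow> \<not> b"
  by (simp add: encode_bool_def)

lemma data_size_encode_bool_le: "data_size (encode_bool b) \<le> 3"
  by (simp add: encode_bool_def)

text \<open>Both branches are evaluated before the test.\<close>

lemma polytime_if:
  assumes P: "polytime_pred P" and f: "polytime f" and g: "polytime g"
  shows "polytime (\<lambda>w. if P w then f w else g w)"
proof (rule polytime_operands[OF f g, where h = "\<lambda>w a b. if P w then a else b"])
  note size = polytime_imp_polybound[OF f] polytime_imp_polybound[OF g]
  show "polybound (\<lambda>w. data_size (if P w then f w else g w))"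
    by (rule polybound_le[OF polybound_add[OF size]]) simp
  fix x y n :: nat assume "x < n" "y < n"
  then obtain c T where "polybound T"
    and impl: "implements c x (n + 2) (n + 3) (\<lambda>w. encode_bool (P w)) T"
    by (auto intro: polytime_imp_implements[OF P, of x "n + 3" "n + 2"])
  let ?select = "If (EVar (n + 2)) (Assign y (EVar n)) (Assign y (EVar (n + 1)))"
  let ?T = "\<lambda>w a b. T w + (data_size a + data_size b + 5)"
  let ?h = "\<lambda>w a b. if P w then a else b"
  have "implements_on_operands (Seq c ?select) x y n ?h ?T"
    unfolding implements_on_operands_def
  proof (intro allI exec_within_Seq[OF implements_exec_within[OF impl]])
    fix s s' assume tested: "assigns (n + 3) (n + 2) (encode_bool (P (s x))) s s'"
    let ?Q = "assigns n y (?h (s x) (s n) (s (n + 1))) s"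
    let ?k = "Suc (data_size (s n) + data_size (s (n + 1)))"
    have "exec_within (Assign y (EVar n)) s' ?k ?Q" if "P (s x)"
      by (rule exec_within_mono[OF exec_within_assigns])
        (use tested that in \<open>auto simp: assigns_def\<close>)
    moreover have "exec_within (Assign y (EVar (n + 1))) s' ?k ?Q" if "\<not> P (s x)"
      by (rule exec_within_mono[OF exec_within_assigns])
        (use tested that in \<open>auto simp: assigns_def\<close>)
    moreover have "s' (n + 2) = encode_bool (P (s x))" using tested by (simp add: assigns_def)
    ultimately show "exec_within ?select s' (data_size (s n) + data_size (s (n + 1)) + 5) ?Q"
      using data_size_encode_bool_le[of "P (s x)"]
      by (intro exec_within_mono[OF exec_within_If[where k = ?k]])
        (auto simp: encode_bool_eq_Nil_iff)
  qed
  moreover have "polybound (\<lambda>w. ?T w (f w) (g w))" by (intro polybound_intros \<open>polybound T\<close> size)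
  ultimately show "\<exists>c T. polybound (\<lambda>w. T w (f w) (g w)) \<and> implements_on_operands c x y n ?h T"
    by (intro exI[of _ "Seq c ?select"] exI[of _ ?T] conjI)
qed

lemma polytime_pred_if:
  assumes "polytime_pred P" "polytime_pred Q" "polytime_pred R"
  shows "polytime_pred (\<lambda>w. if P w then Q w else R w)"
  using polytime_if[OF assms] by (simp add: if_distrib)

lemma polytime_True: "polytime_pred (\<lambda>_. True)"
  and polytime_False: "polytime_pred (\<lambda>_. False)"
  by (rule polytime_const)+

lemma polytime_not: "polytime_pred P \<Longrightarrow> polytime_pred (\<lambda>w. \<not> P w)"
  using polytime_pred_if[OF _ polytime_False polytime_True, of P] by (simp add: if_bool_eq_conj)

lemma polytime_conj: "polytime_pred P \<Longrightarrow> polytime_pred Q \<Longrightarrow> polytime_pred (\<lambda>w. P w \<and> Q w)"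
  using polytime_pred_if[OF _ _ polytime_False, of P Q] by (simp add: if_bool_eq_disj)

lemma polytime_disj: "polytime_pred P \<Longrightarrow> polytime_pred Q \<Longrightarrow> polytime_pred (\<lambda>w. P w \<or> Q w)"
  using polytime_pred_if[OF _ polytime_True, of P Q] by (simp add: if_bool_eq_conj disj_imp)

section \<open>Polynomial-time list processing\<close>

fun data_list :: "data \<Rightarrow> data list" where
  "data_list data.Nil = []"
| "data_list (data.Cons a b) = a # data_list b"

lemma data_list_encode_list [simp]: "data_list (encode_list f xs) = map f xs"
  by (induction xs) auto

lemma encode_list_id_map [simp]: "encode_list id (map f xs) = encode_list f xs"
  by (induction xs) auto

lemma encode_list_eq_Nil_iff: "encode_list f xs = data.Nil \<longleftrightarrow> xs = []"
  by (cases xs) auto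

lemma data_hd_encode_list: "xs \<noteq> [] \<Longrightarrow> data_hd (encode_list f xs) = f (hd xs)"
  by (cases xs) auto

lemma data_tl_encode_list: "data_tl (encode_list f xs) = encode_list f (tl xs)"
  by (cases xs) auto

definition fold_step :: "(data \<Rightarrow> data \<Rightarrow> data \<Rightarrow> data) \<Rightarrow> data \<Rightarrow> data" where
  "fold_step h v = h (data_hd (data_hd v)) (data_tl (data_hd v)) (data_tl v)"

text \<open>The list is in variable \<open>n\<close>, the accumulator in \<open>n + 1\<close>, a parameter of the step in \<open>x\<close>.\<close>

definition fold_body :: "com \<Rightarrow> nat \<Rightarrow> nat \<Rightarrow> com" where
  "fold_body c x n =
     Seq (Assign (n + 2) (ECons (ECons (EHd (EVar n)) (EVar (n + 1))) (EVar x)))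
       (Seq c (Assign n (ETl (EVar n))))"

lemma exec_within_fold_body:
  assumes impl: "implements c (n + 2) (n + 1) (n + 3) (fold_step h) T"
    and "x < n" and s_n: "s n = data.Cons a b"
  shows "exec_within (fold_body c x n) s
    (T (data.Cons (data.Cons a (s (n + 1))) (s x)) +
      10 * (data_size (s n) + data_size (s (n + 1)) + data_size (s x)))
    (\<lambda>s'. s' n = b \<and> s' (n + 1) = h a (s (n + 1)) (s x) \<and> (\<forall>z<n. s' z = s z))"
    (is "exec_within _ _ _ ?Q")
proof -
  let ?v = "data.Cons (data.Cons a (s (n + 1))) (s x)"
  let ?arg = "ECons (ECons (EHd (EVar n)) (EVar (n + 1))) (EVar x)"
  let ?t = "Suc (data_size (s n) + data_size b)"
  have arg: "exec_within (Assign (n + 2) ?arg) s (Suc (expr_time ?arg s))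
      (\<lambda>s'. s' = s(n + 2 := ?v))"
    by (rule exec_within_Assign) (simp add: s_n)
  have step: "exec_within c (s(n + 2 := ?v)) (T ?v)
      (\<lambda>s'. s' (n + 1) = h a (s (n + 1)) (s x) \<and> s' n = s n \<and> (\<forall>z<n. s' z = s z))"
    by (rule exec_within_mono[OF implements_exec_within[OF impl]])
      (auto simp: assigns_def fold_step_def)
  have tail: "exec_within (Assign n (ETl (EVar n))) s' ?t ?Q"
    if "s' (n + 1) = h a (s (n + 1)) (s x) \<and> s' n = s n \<and> (\<forall>z<n. s' z = s z)" for s'
    by (rule exec_within_mono[OF exec_within_Assign[where Q = ?Q]]) (use that s_n in auto)
  have "exec_within (Seq c (Assign n (ETl (EVar n)))) (s(n + 2 := ?v)) (T ?v + ?t) ?Q"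
    using step tail by (rule exec_within_Seq)
  then have "exec_within (fold_body c x n) s (Suc (expr_time ?arg s) + (T ?v + ?t)) ?Q"
    unfolding fold_body_def by (intro exec_within_Seq[OF arg]) simp
  then show ?thesis by (rule exec_within_mono) (simp_all add: s_n)
qed

lemma exec_within_fold_loop:
  assumes impl: "implements c (n + 2) (n + 1) (n + 3) (fold_step h) T"
    and T_le: "\<And>v. T v \<le> poly p (data_size v)"
    and growth: "\<And>e acc. data_size (h e acc w) \<le> data_size e + data_size acc + k"
    and "x < n" and param: "s x = w"
    and size_le: "data_size (s n) * Suc k + data_size (s (n + 1)) \<le> K"
  shows "exec_within (While (EVar n) (fold_body c x n)) s
    (data_size (s n) * (poly p (K + data_size w + 2) + 20 * (K + data_size w)))
    (\<lambda>s'. s' (n + 1) = fold (\<lambda>e acc. h e acc w) (data_list (s n)) (s (n + 1)) \<and>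
      (\<forall>z<n. s' z = s z))"
  using param size_le
proof (induction "s n" arbitrary: s)
  case Nil
  note store = Nil.hyps[symmetric] Nil.prems
  show ?case
    by (rule exec_within_mono[OF exec_within_WhileFalse[where Q = "\<lambda>s'. s' = s"]])
      (use store in auto)
next
  case (Cons a b)
  note store = Cons.hyps(3)[symmetric] Cons.prems(1)
  let ?acc = "s (n + 1)"
  let ?iteration = "poly p (K + data_size w + 2) + 10 * (K + data_size w)"
  let ?bound = "poly p (K + data_size w + 2) + 20 * (K + data_size w)"
  have size: "data_size a + data_size b + data_size ?acc + 1 \<le> K"
    and size_step: "data_size b * Suc k + data_size (h a ?acc w) \<le> K"
    using Cons.prems(2) growth[of a ?acc] by (simp_all add: store(1) add_mult_distrib)
  have step_time: "T (data.Cons (data.Cons a ?acc) w) \<le> poly p (K + data_size w + 2)"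
    using size by (intro order_trans[OF T_le] poly_nat_mono) simp
  have body: "exec_within (fold_body c x n) s ?iteration
      (\<lambda>s'. s' n = b \<and> s' (n + 1) = h a ?acc w \<and> (\<forall>z<n. s' z = s z))"
    by (rule exec_within_mono[OF exec_within_fold_body[OF impl \<open>x < n\<close>, where s = s, OF store(1)]])
      (use size step_time in \<open>auto simp: store\<close>)
  have rest: "exec_within (While (EVar n) (fold_body c x n)) s' (data_size b * ?bound)
      (\<lambda>s'. s' (n + 1) = fold (\<lambda>e acc. h e acc w) (data_list (s n)) ?acc \<and>
        (\<forall>z<n. s' z = s z))"
    if "s' n = b \<and> s' (n + 1) = h a ?acc w \<and> (\<forall>z<n. s' z = s z)" for s'
    by (rule exec_within_mono[OF Cons.hyps(2)[of s']]) (use that size_step store \<open>x < n\<close> in auto)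
  show ?case
    by (rule exec_within_mono[OF exec_within_WhileTrue[OF _ body rest]])
      (use store size in \<open>auto simp: algebra_simps\<close>)
qed

lemma data_size_fold_le:
  assumes "\<And>e acc. data_size (h e acc) \<le> data_size e + data_size acc + k"
  shows "data_size (fold h (data_list l) acc) \<le> data_size l * Suc k + data_size acc"
proof (induction l arbitrary: acc)
  case (Cons a b)
  show ?case using Cons.IH(2)[of "h a acc"] assms[of a acc] by (simp add: algebra_simps)
qed simp

text \<open>
  Without the bound on the growth of the accumulator, folding \<open>\<lambda>_ acc. data.Cons acc acc\<close> would
  produce an exponentially large result.
\<close>

lemma polytime_fold:
  assumes step: "polytime (fold_step h)"
    and l: "polytime l" and a: "polytime a" and g: "polybound g"
    and growth: "\<And>e acc w. data_size (h e acc w) \<le> data_size e + data_size acc + g w"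
  shows "polytime (\<lambda>w. fold (\<lambda>e acc. h e acc w) (data_list (l w)) (a w))"
proof (rule polytime_operands[OF l a, where h = "\<lambda>w d. fold (\<lambda>e acc. h e acc w) (data_list d)"])
  let ?fold = "\<lambda>w d. fold (\<lambda>e acc. h e acc w) (data_list d)"
  let ?K = "\<lambda>w d acc. data_size d * Suc (g w) + data_size acc"
  note size = polytime_imp_polybound[OF l] polytime_imp_polybound[OF a]
  have K_bound: "polybound (\<lambda>w. ?K w (l w) (a w))" by (intro polybound_intros g size)
  have fold_le: "data_size (?fold w d acc) \<le> ?K w d acc" for w d acc
    using growth by (rule data_size_fold_le)
  with K_bound show "polybound (\<lambda>w. data_size (?fold w (l w) (a w)))" by (rule polybound_le)
  fix x y n :: nat assume "x < n" "y < n"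
  obtain c T where "polybound T"
    and impl: "implements c (n + 2) (n + 1) (n + 3) (fold_step h) T"
    by (auto intro: polytime_imp_implements[OF step, of "n + 2" "n + 3" "n + 1"])
  then obtain p where T_le: "\<And>v. T v \<le> poly p (data_size v)" by (auto simp: polybound_def)
  let ?c = "Seq (While (EVar n) (fold_body c x n)) (Assign y (EVar (n + 1)))"
  let ?T = "\<lambda>w d acc. data_size d *
    (poly p (?K w d acc + data_size w + 2) + 20 * (?K w d acc + data_size w)) + Suc (?K w d acc)"
  have "implements_on_operands ?c x y n ?fold ?T"
    unfolding implements_on_operands_def
  proof (intro allI exec_within_Seq)
    fix s
    show "exec_within (While (EVar n) (fold_body c x n)) s (data_size (s n) *
        (poly p (?K (s x) (s n) (s (n + 1)) + data_size (s x) + 2) +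
          20 * (?K (s x) (s n) (s (n + 1)) + data_size (s x))))
        (\<lambda>s'. s' (n + 1) = ?fold (s x) (s n) (s (n + 1)) \<and> (\<forall>z<n. s' z = s z))"
      using impl T_le growth \<open>x < n\<close> refl order_refl by (rule exec_within_fold_loop)
  next
    fix s s'
    assume "s' (n + 1) = ?fold (s x) (s n) (s (n + 1)) \<and> (\<forall>z<n. s' z = s z)"
    then show "exec_within (Assign y (EVar (n + 1))) s' (Suc (?K (s x) (s n) (s (n + 1))))
        (assigns n y (?fold (s x) (s n) (s (n + 1))) s)"
      by (intro exec_within_mono[OF exec_within_assigns]) (use fold_le in \<open>auto simp: assigns_def\<close>)
  qed
  moreover have "polybound (\<lambda>w. ?T w (l w) (a w))" by (intro polybound_intros size K_bound)
  ultimately show "\<exists>c T. polybound (\<lambda>w. T w (l w) (a w)) \<and> implements_on_operands c x y n ?fold T"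
    by (intro exI[of _ ?c] exI[of _ ?T] conjI)
qed

lemma fold_Cons_filter:
  "fold (\<lambda>e acc. if P e then data.Cons e acc else acc) xs (encode_list id ys) =
    encode_list id (rev (filter P xs) @ ys)"
proof (induction xs arbitrary: ys)
  case (Cons x xs)
  show ?case using Cons.IH[of ys] Cons.IH[of "x # ys"] by simp
qed simp

text \<open>A predicate with a parameter is evaluated on the pair of its argument and the parameter.\<close>

lemma polytime_rev_filter:
  assumes P: "polytime_pred (\<lambda>v. P (data_hd v) (data_tl v))" and l: "polytime l"
  shows "polytime (\<lambda>w. encode_list id (rev (filter (\<lambda>e. P e w) (data_list (l w)))))"
proof -
  have "polytime_pred (\<lambda>v. P (data_hd (data_hd v)) (data_tl v))"
    using polytime_comp[OF P, of "\<lambda>v. data.Cons (data_hd (data_hd v)) (data_tl v)"]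
    by (simp add: polytime_Cons polytime_hd polytime_tl polytime_id)
  then have "polytime (\<lambda>w.
      fold (\<lambda>e acc. if P e w then data.Cons e acc else acc) (data_list (l w)) data.Nil)"
    by (intro polytime_fold[where g = "\<lambda>_. 1", unfolded fold_step_def] polytime_if polytime_Cons
        polytime_hd polytime_tl polytime_id polytime_Nil l polybound_const) auto
  then show ?thesis using fold_Cons_filter[where ys = "[]"] by simp
qed

lemma polytime_filter:
  assumes "polytime_pred (\<lambda>v. P (data_hd v) (data_tl v))" "polytime l"
  shows "polytime (\<lambda>w. encode_list id (filter (\<lambda>e. P e w) (data_list (l w))))"
  using polytime_rev_filter[OF polytime_True polytime_rev_filter[OF assms]] by simp

lemma polytime_Bex:
  assumes "polytime_pred (\<lambda>v. P (data_hd v) (data_tl v))" "polytime l"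
  shows "polytime_pred (\<lambda>w. \<exists>e\<in>set (data_list (l w)). P e w)"
  using polytime_not[OF polytime_eq[OF polytime_filter[OF assms] polytime_Nil]]
  by (simp add: encode_list_eq_Nil_iff filter_empty_conv)

lemmas polytime_intros = polytime_id polytime_hd polytime_tl polytime_Cons polytime_const
  polytime_if polytime_filter polytime_eq polytime_not polytime_conj polytime_disj polytime_Bex

section \<open>Stable cutsets as separations\<close>

definition neighbourhood :: "'a pair_pre_digraph \<Rightarrow> 'a \<Rightarrow> 'a set" where
  "neighbourhood G v = {u. (v, u) \<in> parcs G}"

definition separation :: "'a pair_pre_digraph \<Rightarrow> 'a set \<Rightarrow> 'a set \<Rightarrow> 'a set \<Rightarrow> 'a set \<Rightarrow> bool" where
  "separation G V A S B \<longleftrightarrow>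
     V = A \<union> S \<union> B \<and> A \<inter> S = {} \<and> A \<inter> B = {} \<and> S \<inter> B = {} \<and> A \<noteq> {} \<and> B \<noteq> {} \<and>
     stable_set G S \<and> (\<forall>a\<in>A. \<forall>b\<in>B. (a, b) \<notin> parcs G)"

lemma stable_set_subset: "stable_set G S \<Longrightarrow> T \<subseteq> S \<Longrightarrow> stable_set G T"
  unfolding stable_set_def by blast

lemma separation_Int:
  assumes "separation G V A S B" "W \<subseteq> V" "A \<inter> W \<noteq> {}" "B \<inter> W \<noteq> {}"
  shows "separation G W (A \<inter> W) (S \<inter> W) (B \<inter> W)"
  using assms stable_set_subset[of G S "S \<inter> W"] by (auto simp: separation_def)

lemma graph_induce_subgraph:
  assumes "graph H" "U \<subseteq> verts H"
  shows "graph (H \<restriction> U)"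
proof -
  interpret graph H by fact
  have "induced_subgraph (H \<restriction> U) H" using assms(2) by (rule induced_induce)
  then have "digraph (H \<restriction> U)" "sym_digraph (H \<restriction> U)"
    by (auto intro: digraphI_induced induced_graph_imp_graph)
  then show ?thesis by (simp add: graph_def pseudo_graph_def digraph_def)
qed

context graph
begin

lemma two_le_card_sccs_iff_unreachable:
  "2 \<le> card sccs \<longleftrightarrow> (\<exists>u\<in>verts G. \<exists>v\<in>verts G. \<not> u \<rightarrow>\<^sup>* v)"
proof -
  have "scc_of u = scc_of v \<longleftrightarrow> u \<rightarrow>\<^sup>* v" if "v \<in> verts G" for u v
    using that in_scc_of_self[of v] scc_of_eq[of v u] scc_ofI_reachable'[of u v]
    by (auto simp: scc_of_def)
  then have "card (scc_of ` verts G) \<le> Suc 0 \<longleftrightarrow> (\<forall>u\<in>verts G. \<forall>v\<in>verts G. u \<rightarrow>\<^sup>* v)"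
    by (simp add: card_le_Suc0_iff_eq)
  then show ?thesis by (auto simp flip: card_sccs_verts simp: sccs_verts_conv_scc_of)
qed

lemma two_le_card_sccs_iff_cut:
  "2 \<le> card sccs \<longleftrightarrow>
    (\<exists>A\<subseteq>verts G. A \<noteq> {} \<and> A \<noteq> verts G \<and> (\<forall>a\<in>A. \<forall>b\<in>verts G - A. \<not> a \<rightarrow> b))"
  unfolding two_le_card_sccs_iff_unreachable
proof (intro iffI; elim bexE exE conjE)
  fix u v assume "u \<in> verts G" "v \<in> verts G" "\<not> u \<rightarrow>\<^sup>* v"
  then show "\<exists>A\<subseteq>verts G. A \<noteq> {} \<and> A \<noteq> verts G \<and> (\<forall>a\<in>A. \<forall>b\<in>verts G - A. \<not> a \<rightarrow> b)"
    by (intro exI[of _ "{w. u \<rightarrow>\<^sup>* w}"]) (auto dest: reachable_in_verts reachable_adj_trans)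
next
  fix A assume cut: "A \<subseteq> verts G" "A \<noteq> {}" "A \<noteq> verts G" "\<forall>a\<in>A. \<forall>b\<in>verts G - A. \<not> a \<rightarrow> b"
  then obtain u v where "u \<in> A" "v \<in> verts G - A" by blast
  moreover have "w \<in> A" if "u \<rightarrow>\<^sup>* w" for w
    using that
  proof (induct rule: reachable_induct)
    case base
    show ?case by (rule \<open>u \<in> A\<close>)
  next
    case (step w w')
    then show ?case using cut(4) adj_in_verts by blast
  qed
  ultimately show "\<exists>u\<in>verts G. \<exists>v\<in>verts G. \<not> u \<rightarrow>\<^sup>* v" using cut(1) by blast
qed

end

context pair_graph
begin

lemma two_le_card_sccs_induce_subgraph_iff:
  "2 \<le> card (pre_digraph.sccs (with_proj G \<restriction> (pverts G - S))) \<longleftrightarrow>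
    (\<exists>A\<subseteq>pverts G - S. A \<noteq> {} \<and> A \<noteq> pverts G - S \<and>
      (\<forall>a\<in>A. \<forall>b\<in>pverts G - S - A. (a, b) \<notin> parcs G))"
proof -
  interpret H: graph "with_proj G \<restriction> (pverts G - S)"
    by (rule graph_induce_subgraph) (use pair_graphD_graph in auto)
  have dominates: "u \<rightarrow>\<^bsub>with_proj G \<restriction> (pverts G - S)\<^esub> v \<longleftrightarrow>
      (u, v) \<in> parcs G \<and> u \<in> pverts G - S \<and> v \<in> pverts G - S" for u v
    by (auto simp: arcs_ends_def arc_to_ends_def)
  show ?thesis
    unfolding H.two_le_card_sccs_iff_cut dominates induce_subgraph_verts
    by (intro ex_cong1 conj_cong refl ball_cong) blast
qed

lemma stable_cutset_iff_separation:
  "stable_cutset G S \<longleftrightarrow> (\<exists>A B. separation G (pverts G) A S B)"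
  unfolding stable_cutset_def two_le_card_sccs_induce_subgraph_iff
proof (intro iffI; elim exE conjE)
  fix A assume "stable_set G S" "A \<subseteq> pverts G - S" "A \<noteq> {}" "A \<noteq> pverts G - S"
    "\<forall>a\<in>A. \<forall>b\<in>pverts G - S - A. (a, b) \<notin> parcs G"
  then have "separation G (pverts G) A S (pverts G - S - A)"
    by (auto simp: separation_def stable_set_def)
  then show "\<exists>A B. separation G (pverts G) A S B" by blast
next
  fix A B assume "separation G (pverts G) A S B"
  then show "stable_set G S \<and> (\<exists>A\<subseteq>pverts G - S. A \<noteq> {} \<and> A \<noteq> pverts G - S \<and>
      (\<forall>a\<in>A. \<forall>b\<in>pverts G - S - A. (a, b) \<notin> parcs G))"
    unfolding separation_def by (intro conjI exI[of _ A]) auto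
qed

lemma has_stable_cutset_iff_separation:
  "has_stable_cutset G \<longleftrightarrow> (\<exists>A S B. separation G (pverts G) A S B)"
  unfolding has_stable_cutset_def stable_cutset_iff_separation by blast

lemma neighbourhood_subset: "neighbourhood G v \<subseteq> pverts G"
  by (auto simp: neighbourhood_def dest: in_arcsD2)

lemma not_mem_neighbourhood_self: "v \<notin> neighbourhood G v"
  by (auto simp: neighbourhood_def dest: no_loops')

lemma separation_commute:
  assumes "separation G V A S B"
  shows "separation G V B S A"
  using assms by (auto simp: separation_def dest: arcs_symmetric)

lemma stable_neighbourhood_imp_has_stable_cutset:
  assumes "v \<in> pverts G" "stable_set G (neighbourhood G v)" "3 \<le> card (pverts G)"
  shows "has_stable_cutset G"
proof (cases "pverts G = insert v (neighbourhood G v)")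
  case False
  then have "separation G (pverts G)
      {v} (neighbourhood G v) (pverts G - insert v (neighbourhood G v))"
    unfolding separation_def
    using assms neighbourhood_subset[of v] not_mem_neighbourhood_self[of v]
    by (auto simp: neighbourhood_def)
  then show ?thesis using has_stable_cutset_iff_separation by blast
next
  case True
  have "finite (neighbourhood G v)"
    using neighbourhood_subset pair_finite_verts by (rule finite_subset)
  moreover from this have "\<not> card (neighbourhood G v) \<le> Suc 0"
    using True assms(3) not_mem_neighbourhood_self[of v] by simp
  ultimately obtain x y where "x \<in> neighbourhood G v" "y \<in> neighbourhood G v" "x \<noteq> y"
    using card_le_Suc0_iff_eq by blast
  moreover have "stable_set G {v}"
    using assms(1) no_loops' by (auto simp: stable_set_def)
  ultimately have "separation G (pverts G) {x} {v} (neighbourhood G v - {x})"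
    using assms(2) True not_mem_neighbourhood_self[of v]
    unfolding separation_def stable_set_def by blast
  then show ?thesis using has_stable_cutset_iff_separation by blast
qed

end

section \<open>Separations of a vertex cover\<close>

definition sees_all_parts ::
  "'a pair_pre_digraph \<Rightarrow> 'a set \<Rightarrow> 'a set \<Rightarrow> 'a set \<Rightarrow> 'a \<Rightarrow> bool" where
  "sees_all_parts G A S B v \<longleftrightarrow>
     neighbourhood G v \<inter> A \<noteq> {} \<and> neighbourhood G v \<inter> S \<noteq> {} \<and> neighbourhood G v \<inter> B \<noteq> {}"

lemma (in pair_graph) separation_imp_not_sees_all_parts:
  assumes "separation G (pverts G) A S B" "v \<in> pverts G"
  shows "\<not> sees_all_parts G A S B v"
proof
  assume "sees_all_parts G A S B v"
  then obtain a s b where "a \<in> A" "(v, a) \<in> parcs G" "s \<in> S" "(v, s) \<in> parcs G"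
    "b \<in> B" "(v, b) \<in> parcs G"
    unfolding sees_all_parts_def neighbourhood_def by blast
  moreover have "v \<in> A \<union> S \<union> B" using assms by (simp add: separation_def)
  ultimately show False
    using assms(1) arcs_symmetric[of v a] by (auto simp: separation_def stable_set_def)
qed

locale covered_graph = pair_graph G for G :: "'a pair_pre_digraph" +
  fixes X :: "'a set"
  assumes vertex_cover: "vertex_cover G X"
begin

lemma cover_subset: "X \<subseteq> pverts G"
  using vertex_cover by (simp add: vertex_cover_def)

lemma finite_cover: "finite X"
  using cover_subset pair_finite_verts by (rule finite_subset)

lemma neighbourhood_outside_cover_subset: "v \<in> pverts G - X \<Longrightarrow> neighbourhood G v \<subseteq> X"
  using vertex_cover
  by (auto simp: vertex_cover_def stable_set_def neighbourhood_def dest: in_arcsD2)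

text \<open>
  A vertex outside \<open>X\<close> joins \<open>S\<close> if it sees both \<open>A\<close> and \<open>B\<close>, and otherwise a side whose
  opposite it does not see.
\<close>

lemma separation_cover_extends:
  assumes sep: "separation G X A S B"
    and unseen: "\<And>v. v \<in> pverts G - X \<Longrightarrow> \<not> sees_all_parts G A S B v"
  shows "\<exists>A S B. separation G (pverts G) A S B"
proof -
  define sees where "sees C = {v \<in> pverts G - X. neighbourhood G v \<inter> C \<noteq> {}}" for C
  define A' where "A' = A \<union> (pverts G - X - sees B)"
  define S' where "S' = S \<union> (sees A \<inter> sees B)"
  define B' where "B' = B \<union> (sees B - sees A)"
  have outside: "(u, v) \<notin> parcs G" if "u \<in> pverts G - X" "v \<in> pverts G - X" for u v
    using vertex_cover that by (auto simp: vertex_cover_def stable_set_def)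
  have "(s, v) \<notin> parcs G" "(v, s) \<notin> parcs G" if "s \<in> S" "v \<in> sees A \<inter> sees B" for s v
    using that unseen[of v] arcs_symmetric[of s v]
    by (auto simp: sees_def sees_all_parts_def neighbourhood_def)
  moreover have "(u, v) \<notin> parcs G" if "u \<in> sees A \<inter> sees B" "v \<in> sees A \<inter> sees B" for u v
    using that outside by (simp add: sees_def)
  moreover have "stable_set G S" "sees A \<subseteq> pverts G"
    using sep by (auto simp: separation_def sees_def)
  ultimately have "stable_set G S'" unfolding stable_set_def S'_def by blast
  moreover have "(u, v) \<notin> parcs G" if "u \<in> A'" "v \<in> B'" for u v
    using that sep outside[of u v] arcs_symmetric[of u v]
    by (auto simp: A'_def B'_def sees_def separation_def neighbourhood_def)
  moreover have "pverts G = A' \<union> S' \<union> B'" "A' \<inter> S' = {}" "A' \<inter> B' = {}" "S' \<inter> B' = {}"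
    "A' \<noteq> {}" "B' \<noteq> {}"
    using sep cover_subset by (auto simp: A'_def S'_def B'_def sees_def separation_def)
  ultimately have "separation G (pverts G) A' S' B'" by (simp add: separation_def)
  then show ?thesis by blast
qed

end

locale unstable_cover = covered_graph +
  assumes unstable_neighbourhood: "v \<in> pverts G - X \<Longrightarrow> \<not> stable_set G (neighbourhood G v)"
begin

lemma separation_side_meets_cover:
  assumes "separation G (pverts G) A S B"
  shows "A \<inter> X \<noteq> {}"
proof -
  obtain a where a: "a \<in> A" "a \<in> pverts G" using assms by (auto simp: separation_def)
  show ?thesis
  proof (cases "a \<in> X")
    case False
    with a have outside: "a \<in> pverts G - X" by blast
    have "\<not> neighbourhood G a \<subseteq> S"
      using unstable_neighbourhood[OF outside] assms stable_set_subset
      by (auto simp: separation_def)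
    then obtain x where "x \<in> neighbourhood G a" "x \<notin> S" by blast
    moreover from this have "x \<in> A"
      using assms a neighbourhood_subset[of a] unfolding separation_def neighbourhood_def by blast
    ultimately show ?thesis using neighbourhood_outside_cover_subset[OF outside] by blast
  qed (use a in blast)
qed

theorem has_stable_cutset_iff_separation_cover:
  "has_stable_cutset G \<longleftrightarrow>
    (\<exists>A S B. separation G X A S B \<and> \<not> (\<exists>v\<in>pverts G - X. sees_all_parts G A S B v))"
  unfolding has_stable_cutset_iff_separation
proof (intro iffI; elim exE conjE)
  fix A S B assume sep: "separation G (pverts G) A S B"
  have "separation G X (A \<inter> X) (S \<inter> X) (B \<inter> X)"
    using separation_Int[OF sep cover_subset] separation_side_meets_cover[OF sep]
      separation_side_meets_cover[OF separation_commute[OF sep]] by blast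
  moreover have "\<not> sees_all_parts G (A \<inter> X) (S \<inter> X) (B \<inter> X) v" if "v \<in> pverts G" for v
    using separation_imp_not_sees_all_parts[OF sep that] by (auto simp: sees_all_parts_def)
  ultimately show "\<exists>A S B. separation G X A S B \<and>
      \<not> (\<exists>v\<in>pverts G - X. sees_all_parts G A S B v)"
    by blast
next
  fix A S B assume "separation G X A S B" "\<not> (\<exists>v\<in>pverts G - X. sees_all_parts G A S B v)"
  then show "\<exists>A S B. separation G (pverts G) A S B" by (intro separation_cover_extends) auto
qed

end

section \<open>Deleting vertices outside the cover\<close>

definition restrict_graph :: "'a pair_pre_digraph \<Rightarrow> 'a set \<Rightarrow> 'a pair_pre_digraph" where
  "restrict_graph G V = \<lparr>pverts = V, parcs = parcs G \<inter> V \<times> V\<rparr>"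

lemma restrict_graph_simps [simp]:
  "pverts (restrict_graph G V) = V"
  "parcs (restrict_graph G V) = parcs G \<inter> V \<times> V"
  by (simp_all add: restrict_graph_def)

lemma stable_set_restrict_graph:
  assumes "V \<subseteq> pverts G"
  shows "stable_set (restrict_graph G V) S \<longleftrightarrow> S \<subseteq> V \<and> stable_set G S"
proof (cases "S \<subseteq> V")
  case True
  then have "(u, v) \<in> parcs (restrict_graph G V) \<longleftrightarrow> (u, v) \<in> parcs G" if "u \<in> S" "v \<in> S" for u v
    using that by auto
  then show ?thesis using True assms by (simp add: stable_set_def subset_trans[OF True assms])
qed (simp add: stable_set_def)

lemma separation_restrict_graph:
  assumes "X \<subseteq> V" "V \<subseteq> pverts G"
  shows "separation (restrict_graph G V) X A S B \<longleftrightarrow> separation G X A S B"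
proof -
  have "(a, b) \<in> parcs (restrict_graph G V) \<longleftrightarrow> (a, b) \<in> parcs G" if "a \<in> X" "b \<in> X" for a b
    using that assms(1) by auto
  then show ?thesis
    using assms unfolding separation_def stable_set_restrict_graph[OF assms(2)] by blast
qed

lemma (in pair_graph) pair_graph_restrict_graph:
  assumes "V \<subseteq> pverts G"
  shows "pair_graph (restrict_graph G V)"
proof (rule pair_graphI_graph)
  have "parcs (restrict_graph G V) = {e \<in> parcs G. fst e \<in> V \<and> snd e \<in> V}" by auto
  then have "with_proj (restrict_graph G V) = with_proj G \<restriction> V"
    by (simp add: with_proj_def induce_subgraph_def)
  then show "graph (with_proj (restrict_graph G V))"
    using graph_induce_subgraph[OF pair_graphD_graph, of V] assms by simp
qed

context covered_graph
begin

lemma covered_graph_restrict_graph: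
  assumes "X \<subseteq> V" "V \<subseteq> pverts G"
  shows "covered_graph (restrict_graph G V) X"
proof (intro covered_graph.intro covered_graph_axioms.intro pair_graph_restrict_graph)
  show "vertex_cover (restrict_graph G V) X"
    using assms vertex_cover stable_set_subset[of G "pverts G - X" "V - X"]
    by (auto simp: vertex_cover_def stable_set_restrict_graph)
qed (rule assms(2))

lemma neighbourhood_restrict_graph:
  assumes "X \<subseteq> V" "V \<subseteq> pverts G" "v \<in> V - X"
  shows "neighbourhood (restrict_graph G V) v = neighbourhood G v"
proof -
  have "v \<in> pverts G - X" using assms by blast
  then have "neighbourhood G v \<subseteq> V" using neighbourhood_outside_cover_subset assms(1) by blast
  then show ?thesis using assms(3) by (auto simp: neighbourhood_def)
qed

lemma ex_sees_all_parts_restrict_graph_iff: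
  assumes "X \<subseteq> V" "V \<subseteq> pverts G"
    and rep: "\<And>x y z v. v \<in> pverts G - X \<Longrightarrow> {x, y, z} \<subseteq> neighbourhood G v \<Longrightarrow>
      \<exists>u\<in>V - X. {x, y, z} \<subseteq> neighbourhood G u"
  shows "(\<exists>v\<in>V - X. sees_all_parts (restrict_graph G V) A S B v) \<longleftrightarrow>
    (\<exists>v\<in>pverts G - X. sees_all_parts G A S B v)"
proof
  assume "\<exists>v\<in>V - X. sees_all_parts (restrict_graph G V) A S B v"
  then show "\<exists>v\<in>pverts G - X. sees_all_parts G A S B v"
    using assms(1,2) by (auto simp: sees_all_parts_def neighbourhood_restrict_graph)
next
  assume "\<exists>v\<in>pverts G - X. sees_all_parts G A S B v"
  then obtain v a s b where "v \<in> pverts G - X" "{a, s, b} \<subseteq> neighbourhood G v"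
    and parts: "a \<in> A" "s \<in> S" "b \<in> B"
    unfolding sees_all_parts_def by blast
  then obtain u where "u \<in> V - X" "{a, s, b} \<subseteq> neighbourhood G u" using rep by meson
  with parts show "\<exists>v\<in>V - X. sees_all_parts (restrict_graph G V) A S B v"
    using assms(1,2) by (auto simp: sees_all_parts_def neighbourhood_restrict_graph)
qed

end

context unstable_cover
begin

lemma unstable_cover_restrict_graph:
  assumes "X \<subseteq> V" "V \<subseteq> pverts G"
  shows "unstable_cover (restrict_graph G V) X"
proof (intro unstable_cover.intro unstable_cover_axioms.intro covered_graph_restrict_graph assms)
  fix v assume "v \<in> pverts (restrict_graph G V) - X"
  then have "v \<in> V - X" "v \<in> pverts G - X" using assms(2) by auto
  then show "\<not> stable_set (restrict_graph G V) (neighbourhood (restrict_graph G V) v)"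
    using unstable_neighbourhood
    by (simp add: neighbourhood_restrict_graph[OF assms] stable_set_restrict_graph[OF assms(2)])
qed

lemma has_stable_cutset_restrict_graph_iff:
  assumes V: "X \<subseteq> V" "V \<subseteq> pverts G"
    and rep: "\<And>x y z v. v \<in> pverts G - X \<Longrightarrow> {x, y, z} \<subseteq> neighbourhood G v \<Longrightarrow>
      \<exists>u\<in>V - X. {x, y, z} \<subseteq> neighbourhood G u"
  shows "has_stable_cutset (restrict_graph G V) \<longleftrightarrow> has_stable_cutset G"
proof -
  interpret H: unstable_cover "restrict_graph G V" X
    using V by (rule unstable_cover_restrict_graph)
  have "(\<exists>v\<in>V - X. sees_all_parts (restrict_graph G V) A S B v) \<longleftrightarrow>
      (\<exists>v\<in>pverts G - X. sees_all_parts G A S B v)" for A S B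
    using V rep by (rule ex_sees_all_parts_restrict_graph_iff)
  then show ?thesis
    by (simp only: H.has_stable_cutset_iff_separation_cover has_stable_cutset_iff_separation_cover
        separation_restrict_graph[OF V] restrict_graph_simps)
qed

end

definition kernel_verts :: "'a pair_pre_digraph \<Rightarrow> 'a set \<Rightarrow> ('a \<Rightarrow> 'a \<Rightarrow> 'a \<Rightarrow> 'a) \<Rightarrow> 'a set" where
  "kernel_verts G X rep = X \<union> {v \<in> pverts G - X.
     \<exists>x\<in>X. \<exists>y\<in>X. \<exists>z\<in>X. {x, y, z} \<subseteq> neighbourhood G v \<and> rep x y z = v}"

context covered_graph
begin

lemma kernel_verts_bounds: "X \<subseteq> kernel_verts G X rep" "kernel_verts G X rep \<subseteq> pverts G"
  using cover_subset by (auto simp: kernel_verts_def)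

lemma card_kernel_verts_le: "card (kernel_verts G X rep) \<le> card X + card X ^ 3"
proof -
  let ?R = "(\<lambda>(x, y, z). rep x y z) ` (X \<times> X \<times> X)"
  have "kernel_verts G X rep \<subseteq> X \<union> ?R" unfolding kernel_verts_def by force
  then have "card (kernel_verts G X rep) \<le> card (X \<union> ?R)"
    by (intro card_mono) (auto simp: finite_cover)
  also have "\<dots> \<le> card X + card ?R" by (rule card_Un_le)
  also have "card ?R \<le> card (X \<times> X \<times> X)" by (rule card_image_le) (simp add: finite_cover)
  also have "\<dots> = card X ^ 3" by (simp add: card_cartesian_product power3_eq_cube)
  finally show ?thesis by simp
qed

end

lemma (in unstable_cover) has_stable_cutset_kernel_iff:
  assumes rep: "\<And>x y z v. v \<in> pverts G - X \<Longrightarrow> {x, y, z} \<subseteq> neighbourhood G v \<Longrightarrow>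
      rep x y z \<in> pverts G - X \<and> {x, y, z} \<subseteq> neighbourhood G (rep x y z)"
  shows "has_stable_cutset (restrict_graph G (kernel_verts G X rep)) \<longleftrightarrow> has_stable_cutset G"
proof (rule has_stable_cutset_restrict_graph_iff[OF kernel_verts_bounds])
  fix x y z v assume v: "v \<in> pverts G - X" "{x, y, z} \<subseteq> neighbourhood G v"
  then have "{x, y, z} \<subseteq> X" using neighbourhood_outside_cover_subset by blast
  then have "rep x y z \<in> kernel_verts G X rep - X"
    using rep[OF v] by (simp add: kernel_verts_def) blast
  then show "\<exists>u\<in>kernel_verts G X rep - X. {x, y, z} \<subseteq> neighbourhood G u"
    using rep[OF v] by blast
qed

section \<open>The kernelization on encoded instances\<close>

definition adjacent :: "data \<Rightarrow> data \<Rightarrow> data \<Rightarrow> bool" where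
  "adjacent es u v \<longleftrightarrow> data.Cons u v \<in> set (data_list es) \<or> data.Cons v u \<in> set (data_list es)"

definition outer_neighbour :: "data \<Rightarrow> data \<Rightarrow> data \<Rightarrow> data \<Rightarrow> data \<Rightarrow> data \<Rightarrow> bool" where
  "outer_neighbour es xs x y z v \<longleftrightarrow>
     v \<notin> set (data_list xs) \<and> adjacent es v x \<and> adjacent es v y \<and> adjacent es v z"

definition representative :: "data \<Rightarrow> data \<Rightarrow> data \<Rightarrow> data \<Rightarrow> data \<Rightarrow> data \<Rightarrow> data" where
  "representative vs es xs x y z =
     data_hd (encode_list id (filter (outer_neighbour es xs x y z) (data_list vs)))"

text \<open>
  The conjunct \<open>outer_neighbour es xs x y z v\<close> excludes triples without a common neighbour: their
  representative is the head of the empty list, nil, which encodes the vertex \<open>0\<close>.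
\<close>

definition kept :: "data \<Rightarrow> data \<Rightarrow> data \<Rightarrow> data \<Rightarrow> bool" where
  "kept vs es xs v \<longleftrightarrow> v \<in> set (data_list xs) \<or>
     (\<exists>x\<in>set (data_list xs). \<exists>y\<in>set (data_list xs). \<exists>z\<in>set (data_list xs).
        outer_neighbour es xs x y z v \<and> representative vs es xs x y z = v)"

definition stable_outer_neighbourhood :: "data \<Rightarrow> data \<Rightarrow> data \<Rightarrow> bool" where
  "stable_outer_neighbourhood vs es xs \<longleftrightarrow>
     (\<exists>v\<in>set (data_list vs). v \<notin> set (data_list xs) \<and>
        \<not> (\<exists>x\<in>set (data_list xs). \<exists>y\<in>set (data_list xs).
             adjacent es v x \<and> adjacent es v y \<and> adjacent es x y))"

definition yes_instance :: data where
  "yes_instance = data.Cons (encode_list encode_nat [0, 1]) (data.Cons data.Nil data.Nil)"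

definition restrict_instance :: "data \<Rightarrow> data \<Rightarrow> data \<Rightarrow> data" where
  "restrict_instance vs es xs =
     data.Cons (encode_list id (filter (kept vs es xs) (data_list vs)))
       (data.Cons
         (encode_list id
           (filter (\<lambda>e. kept vs es xs (data_hd e) \<and> kept vs es xs (data_tl e)) (data_list es)))
         xs)"

definition kernel :: "data \<Rightarrow> data \<Rightarrow> data \<Rightarrow> data" where
  "kernel vs es xs =
     (if data_tl (data_tl vs) = data.Nil then data.Cons vs (data.Cons es xs)
      else if stable_outer_neighbourhood vs es xs then yes_instance
      else restrict_instance vs es xs)"

lemma polytime_kernel:
  "polytime (\<lambda>w. kernel (data_hd w) (data_hd (data_tl w)) (data_tl (data_tl w)))"
proof -
  have mem_iff_ex_eq: "a \<in> set xs \<longleftrightarrow> (\<exists>e\<in>set xs. e = a)" for a and xs :: "data list" by simp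
  show ?thesis
    unfolding kernel_def restrict_instance_def stable_outer_neighbourhood_def kept_def
      representative_def outer_neighbour_def adjacent_def mem_iff_ex_eq
    by (intro polytime_intros)
qed

lemma encode_nat_eq_iff [simp]: "encode_nat m = encode_nat n \<longleftrightarrow> m = n"
  using inj_encode_nat by (auto dest: injD)

lemma data_hd_encode_edge [simp]: "data_hd (encode_edge e) = encode_nat (fst e)"
  and data_tl_encode_edge [simp]: "data_tl (encode_edge e) = encode_nat (snd e)"
  by (simp_all add: encode_edge_def)

definition two_isolated :: "nat pair_pre_digraph" where
  "two_isolated = \<lparr>pverts = {0, 1}, parcs = {}\<rparr>"

lemma pair_graph_two_isolated: "pair_graph two_isolated"
  by unfold_locales (auto simp: two_isolated_def symmetric_def sym_def)

lemma has_stable_cutset_two_isolated: "has_stable_cutset two_isolated"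
proof -
  have "separation two_isolated (pverts two_isolated) {0} {} {1}"
    by (auto simp: separation_def stable_set_def two_isolated_def)
  then show ?thesis
    using pair_graph.has_stable_cutset_iff_separation[OF pair_graph_two_isolated] by blast
qed

definition encodes_kernel :: "data \<Rightarrow> nat pair_pre_digraph \<Rightarrow> nat set \<Rightarrow> bool" where
  "encodes_kernel w G X \<longleftrightarrow>
     (\<exists>H Y. encodes_instance w H Y \<and> pair_graph H \<and> vertex_cover H Y \<and>
        (has_stable_cutset H \<longleftrightarrow> has_stable_cutset G) \<and>
        (card (pverts H) \<le> 2 * card X ^ 3 \<or> card (pverts H) \<le> 2))"

lemma encodes_kernel_yes_instance:
  assumes "has_stable_cutset G"
  shows "encodes_kernel yes_instance G X"
proof -
  have "encodes_instance yes_instance two_isolated {}"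
    unfolding encodes_instance_def yes_instance_def two_isolated_def
    by (intro exI[of _ "[0, 1]"] exI[of _ "[]"]) auto
  moreover have "vertex_cover two_isolated {}" "card (pverts two_isolated) \<le> 2"
    by (auto simp: two_isolated_def vertex_cover_def stable_set_def)
  ultimately show ?thesis
    unfolding encodes_kernel_def
    using assms pair_graph_two_isolated has_stable_cutset_two_isolated by blast
qed

locale encoded_instance = covered_graph G X for G :: "nat pair_pre_digraph" and X +
  fixes vs :: "nat list" and es :: "(nat \<times> nat) list" and xs :: "nat list"
  assumes vertices: "distinct vs" "set vs = pverts G"
    and edges: "distinct (map (\<lambda>(u, v). {u, v}) es)" "set es \<union> (set es)\<inverse> = parcs G"
    and cover_list: "distinct xs" "set xs = X"
begin

abbreviation vs_code :: data where "vs_code \<equiv> encode_list encode_nat vs"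
abbreviation es_code :: data where "es_code \<equiv> encode_list encode_edge es"
abbreviation xs_code :: data where "xs_code \<equiv> encode_list encode_nat xs"

lemma adjacent_iff: "adjacent es_code (encode_nat u) (encode_nat v) \<longleftrightarrow> v \<in> neighbourhood G u"
proof -
  have "data.Cons (encode_nat a) (encode_nat b) \<in> encode_edge ` set es \<longleftrightarrow> (a, b) \<in> set es" for a b
    by (force simp: encode_edge_def)
  then show ?thesis by (auto simp: adjacent_def neighbourhood_def simp flip: edges(2))
qed

lemma encode_nat_mem_cover_iff: "encode_nat v \<in> set (data_list xs_code) \<longleftrightarrow> v \<in> X"
  using cover_list(2) by auto

lemma stable_outer_neighbourhood_iff:
  "stable_outer_neighbourhood vs_code es_code xs_code \<longleftrightarrow>
    (\<exists>v\<in>pverts G - X. stable_set G (neighbourhood G v))"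
proof -
  have "stable_outer_neighbourhood vs_code es_code xs_code \<longleftrightarrow>
      (\<exists>v\<in>pverts G - X. \<not> (\<exists>x\<in>X. \<exists>y\<in>X. x \<in> neighbourhood G v \<and> y \<in> neighbourhood G v \<and>
        y \<in> neighbourhood G x))"
    by (auto simp: stable_outer_neighbourhood_def adjacent_iff cover_list vertices)
  also have "\<dots> \<longleftrightarrow> (\<exists>v\<in>pverts G - X. stable_set G (neighbourhood G v))"
  proof (intro bex_cong refl)
    fix v assume "v \<in> pverts G - X"
    then have "neighbourhood G v \<subseteq> X" by (rule neighbourhood_outside_cover_subset)
    then show "\<not> (\<exists>x\<in>X. \<exists>y\<in>X. x \<in> neighbourhood G v \<and> y \<in> neighbourhood G v \<and>
        y \<in> neighbourhood G x) \<longleftrightarrow> stable_set G (neighbourhood G v)"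
      using neighbourhood_subset[of v] by (auto simp: stable_set_def neighbourhood_def)
  qed
  finally show ?thesis .
qed

definition representative_vertex :: "nat \<Rightarrow> nat \<Rightarrow> nat \<Rightarrow> nat" where
  "representative_vertex x y z = hd (filter (\<lambda>v. v \<notin> X \<and> {x, y, z} \<subseteq> neighbourhood G v) vs)"

lemma outer_neighbour_iff:
  "outer_neighbour es_code xs_code (encode_nat x) (encode_nat y) (encode_nat z) (encode_nat v) \<longleftrightarrow>
    v \<notin> X \<and> {x, y, z} \<subseteq> neighbourhood G v"
  by (simp only: outer_neighbour_def encode_nat_mem_cover_iff adjacent_iff) simp

lemma representative_vertex:
  assumes "v \<in> pverts G - X" "{x, y, z} \<subseteq> neighbourhood G v"
  shows "representative_vertex x y z \<in> pverts G - X \<and>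
      {x, y, z} \<subseteq> neighbourhood G (representative_vertex x y z)"
    and "representative vs_code es_code xs_code (encode_nat x) (encode_nat y) (encode_nat z) =
      encode_nat (representative_vertex x y z)"
proof -
  let ?reps = "filter (\<lambda>v. v \<notin> X \<and> {x, y, z} \<subseteq> neighbourhood G v) vs"
  have nonempty: "?reps \<noteq> []" using assms vertices(2) by (auto simp: filter_empty_conv)
  then have "hd ?reps \<in> set ?reps" by (rule hd_in_set)
  then show "representative_vertex x y z \<in> pverts G - X \<and>
      {x, y, z} \<subseteq> neighbourhood G (representative_vertex x y z)"
    by (simp add: representative_vertex_def vertices(2))
  from nonempty
  show "representative vs_code es_code xs_code (encode_nat x) (encode_nat y) (encode_nat z) =
      encode_nat (representative_vertex x y z)"
    by (simp add: representative_def data_hd_encode_list filter_map comp_def outer_neighbour_iff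
        representative_vertex_def)
qed

lemma kept_iff:
  assumes "v \<in> pverts G"
  shows "kept vs_code es_code xs_code (encode_nat v) \<longleftrightarrow> v \<in> kernel_verts G X representative_vertex"
proof -
  have "kept vs_code es_code xs_code (encode_nat v) \<longleftrightarrow> v \<in> X \<or>
      (\<exists>x\<in>X. \<exists>y\<in>X. \<exists>z\<in>X. (v \<notin> X \<and> {x, y, z} \<subseteq> neighbourhood G v) \<and>
        representative vs_code es_code xs_code (encode_nat x) (encode_nat y) (encode_nat z) =
          encode_nat v)"
    unfolding kept_def encode_nat_mem_cover_iff
    by (simp only: data_list_encode_list set_map bex_simps outer_neighbour_iff cover_list)
  also have "\<dots> \<longleftrightarrow> v \<in> X \<or>
      (\<exists>x\<in>X. \<exists>y\<in>X. \<exists>z\<in>X. (v \<notin> X \<and> {x, y, z} \<subseteq> neighbourhood G v) \<and>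
        representative_vertex x y z = v)"
  proof (intro disj_cong bex_cong conj_cong refl)
    fix x y z assume "v \<notin> X \<and> {x, y, z} \<subseteq> neighbourhood G v"
    then show "representative vs_code es_code xs_code (encode_nat x) (encode_nat y) (encode_nat z) =
        encode_nat v \<longleftrightarrow> representative_vertex x y z = v"
      using assms representative_vertex(2)[of v x y z] by simp
  qed
  also have "\<dots> \<longleftrightarrow> v \<in> kernel_verts G X representative_vertex"
    using assms by (auto simp: kernel_verts_def)
  finally show ?thesis .
qed

lemma encodes_instance_restrict_instance:
  "encodes_instance (restrict_instance vs_code es_code xs_code)
    (restrict_graph G (kernel_verts G X representative_vertex)) X"
proof -
  let ?V = "kernel_verts G X representative_vertex"
  let ?vs = "filter (\<lambda>v. v \<in> ?V) vs" and ?es = "filter (\<lambda>e. fst e \<in> ?V \<and> snd e \<in> ?V) es"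
  have "fst e \<in> pverts G" "snd e \<in> pverts G" if "e \<in> set es" for e
  proof -
    have "(fst e, snd e) \<in> parcs G" using that edges(2) by auto
    then show "fst e \<in> pverts G" "snd e \<in> pverts G" by (auto dest: in_arcsD1 in_arcsD2)
  qed
  moreover have "kept vs_code es_code xs_code (encode_nat v) \<longleftrightarrow> v \<in> ?V" if "v \<in> set vs" for v
    using that vertices(2) kept_iff by blast
  ultimately have "restrict_instance vs_code es_code xs_code =
      data.Cons (encode_list encode_nat ?vs) (data.Cons (encode_list encode_edge ?es) xs_code)"
    by (simp add: restrict_instance_def filter_map comp_def kept_iff cong: filter_cong)
  moreover have "distinct ?vs" "set ?vs = ?V"
    using vertices kernel_verts_bounds(2)[of representative_vertex] by auto
  moreover have "distinct (map (\<lambda>(u, v). {u, v}) ?es)"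
    using edges(1) by (simp add: distinct_map_filter)
  moreover have "set ?es \<union> (set ?es)\<inverse> = parcs (restrict_graph G ?V)"
    using edges(2) by auto
  ultimately show ?thesis
    unfolding encodes_instance_def restrict_graph_simps using cover_list by blast
qed

lemma encodes_kernel_restrict_instance:
  assumes "\<And>v. v \<in> pverts G - X \<Longrightarrow> \<not> stable_set G (neighbourhood G v)"
  shows "encodes_kernel (restrict_instance vs_code es_code xs_code) G X"
proof -
  let ?V = "kernel_verts G X representative_vertex"
  interpret unstable_cover G X using assms by unfold_locales
  interpret H: covered_graph "restrict_graph G ?V" X
    by (rule covered_graph_restrict_graph[OF kernel_verts_bounds])
  have "has_stable_cutset (restrict_graph G ?V) \<longleftrightarrow> has_stable_cutset G"
    using representative_vertex(1) by (rule has_stable_cutset_kernel_iff)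
  moreover have "card X \<le> card X ^ 3" by (cases "card X") (simp_all add: power3_eq_cube)
  then have "card ?V \<le> 2 * card X ^ 3" using card_kernel_verts_le[of representative_vertex] by simp
  ultimately show ?thesis
    unfolding encodes_kernel_def
    using encodes_instance_restrict_instance H.pair_graph H.vertex_cover restrict_graph_simps(1)
    by metis
qed

lemma encodes_kernel_kernel: "encodes_kernel (kernel vs_code es_code xs_code) G X"
proof -
  have card_vs: "length vs = card (pverts G)" using vertices distinct_card by metis
  have small_iff: "data_tl (data_tl vs_code) = data.Nil \<longleftrightarrow> card (pverts G) \<le> 2"
    by (simp add: data_tl_encode_list encode_list_eq_Nil_iff flip: card_vs length_0_conv) arith
  consider (small) "card (pverts G) \<le> 2"
    | (stable) v where "\<not> card (pverts G) \<le> 2"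
        "v \<in> pverts G - X" "stable_set G (neighbourhood G v)"
    | (unstable) "\<not> card (pverts G) \<le> 2"
        "\<And>v. v \<in> pverts G - X \<Longrightarrow> \<not> stable_set G (neighbourhood G v)"
    by blast
  then show ?thesis
  proof cases
    case small
    then have "encodes_instance (kernel vs_code es_code xs_code) G X"
      using vertices edges cover_list by (auto simp: kernel_def encodes_instance_def small_iff)
    with small show ?thesis unfolding encodes_kernel_def using vertex_cover pair_graph by blast
  next
    case stable
    then have "kernel vs_code es_code xs_code = yes_instance"
      by (auto simp: kernel_def small_iff stable_outer_neighbourhood_iff)
    moreover have "has_stable_cutset G"
      using stable by (intro stable_neighbourhood_imp_has_stable_cutset[of v]) auto
    ultimately show ?thesis by (simp add: encodes_kernel_yes_instance)
  next
    case unstable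
    then have "kernel vs_code es_code xs_code = restrict_instance vs_code es_code xs_code"
      by (auto simp: kernel_def small_iff stable_outer_neighbourhood_iff)
    then show ?thesis using encodes_kernel_restrict_instance unstable(2) by simp
  qed
qed

end

theorem theorem3:
  shows "\<exists>(kernelize :: com) (p :: nat poly) (c :: nat).
    \<forall>(G :: nat pair_pre_digraph) (X :: nat set) (w :: data).
      pair_graph G \<longrightarrow> vertex_cover G X \<longrightarrow> encodes_instance w G X \<longrightarrow>
      (\<exists>(G' :: nat pair_pre_digraph) (X' :: nat set) (w' :: data) (t :: nat).
         computes kernelize w t w' \<and> t \<le> poly p (data_size w) \<and>
         encodes_instance w' G' X' \<and> pair_graph G' \<and> vertex_cover G' X' \<and>
         (has_stable_cutset G' \<longleftrightarrow> has_stable_cutset G) \<and>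
         (card (pverts G') \<le> c * card X ^ 3 \<or> card (pverts G') \<le> c))"
proof -
  let ?kernel = "\<lambda>w. kernel (data_hd w) (data_hd (data_tl w)) (data_tl (data_tl w))"
  obtain c p where computed: "\<And>w. \<exists>t. computes c w t (?kernel w) \<and> t \<le> poly p (data_size w)"
    using polytime_kernel by (rule polytime_computes) blast
  have "encodes_kernel (?kernel w) G X"
    if instance_w: "pair_graph G" "vertex_cover G X" "encodes_instance w G X" for G X w
  proof -
    obtain vs es xs where "w = data.Cons (encode_list encode_nat vs)
        (data.Cons (encode_list encode_edge es) (encode_list encode_nat xs))"
      and "encoded_instance G X vs es xs"
      using instance_w unfolding encodes_instance_def encoded_instance_def
        encoded_instance_axioms_def covered_graph_def covered_graph_axioms_def by blast
    then show ?thesis using encoded_instance.encodes_kernel_kernel by simp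
  qed
  with computed show ?thesis
    unfolding encodes_kernel_def by (intro exI[of _ c] exI[of _ p] exI[of _ 2]) blast
qed

end
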